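(* Let $\alpha,\beta\in\mathbb{R}^2$ with $\alpha\succ(1,1)$ and $\beta\preceq\alpha$. Then $\mathcal{M}(D_\alpha,D_\beta)=D_\beta$.
   Context: $\mathbb{U}$ is the open unit disc in $\mathbb{C}$, $\mathbb{U}^2=\mathbb{U}\times\mathbb{U}$, and $\mathbb{Z}_+$ is the set of nonnegative integers. For $\alpha=(\alpha_1,\alpha_2)\in\mathbb{R}^2$, $D_\alpha$ is the space of functions $f(z,w)=\sum_{(k,l)\in\mathbb{Z}_+^2}a_{k,l}z^kw^l$ on $\mathbb{U}^2$ with $\sum_{(k,l)}|a_{k,l}|^2(k+1)^{\alpha_1}(l+1)^{\alpha_2}<\infty$. $\mathcal{M}(D_\alpha,D_\beta)$ is the set of functions $\phi:\mathbb{U}^2\to\mathbb{C}$ such that $\phi f\in D_\beta$ for all $f\in D_\alpha$. For $\alpha,\beta\in\mathbb{R}^2$: $\alpha\succ\beta$ means $\alpha_1>\beta_1$ and $\alpha_2>\beta_2$; $\beta\preceq\alpha$ means $\beta_1\le\alpha_1$ and $\beta_2\le\alpha_2$. *)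

theory Defs
  imports "HOL-Analysis.Analysis"
begin

definition bidisc :: "(complex \<times> complex) set" where
  "bidisc = ball 0 1 \<times> ball 0 1"

text \<open>
  A function on the bidisc is a total function of type \<^typ>\<open>complex \<times> complex \<Rightarrow> complex\<close> that
  is \<^const>\<open>extensional\<close> on \<^const>\<open>bidisc\<close>, so that equality of such objects is equality of
  functions on the bidisc. The weights make the power series converge absolutely on
  the whole bidisc, so unconditional summation over pairs \<open>(k, l)\<close> loses no generality.
\<close>

definition D_space :: "real \<times> real \<Rightarrow> (complex \<times> complex \<Rightarrow> complex) set" where
  "D_space \<alpha> = {f \<in> extensional bidisc.
     \<exists>a :: nat \<times> nat \<Rightarrow> complex.
       (\<forall>(z, w) \<in> bidisc. ((\<lambda>(k, l). a (k, l) * z ^ k * w ^ l) has_sum f (z, w)) UNIV) \<and>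
       (\<lambda>(k, l). (cmod (a (k, l)))\<^sup>2 * (real k + 1) powr fst \<alpha> * (real l + 1) powr snd \<alpha>)
         summable_on UNIV}"

definition multipliers :: "real \<times> real \<Rightarrow> real \<times> real \<Rightarrow> (complex \<times> complex \<Rightarrow> complex) set" where
  "multipliers \<alpha> \<beta> = {\<phi> \<in> extensional bidisc.
     \<forall>f \<in> D_space \<alpha>. restrict (\<lambda>p. \<phi> p * f p) bidisc \<in> D_space \<beta>}"

text \<open>
  The relations below are componentwise in both coordinates; the strict one is not the
  strict part of the other.
\<close>

definition pair_gt :: "real \<times> real \<Rightarrow> real \<times> real \<Rightarrow> bool" (infix "\<succ>" 50) where
  "\<alpha> \<succ> \<beta> \<longleftrightarrow> fst \<alpha> > fst \<beta> \<and> snd \<alpha> > snd \<beta>"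

definition pair_le :: "real \<times> real \<Rightarrow> real \<times> real \<Rightarrow> bool" (infix "\<preceq>" 50) where
  "\<beta> \<preceq> \<alpha> \<longleftrightarrow> fst \<beta> \<le> fst \<alpha> \<and> snd \<beta> \<le> snd \<alpha>"

end

theory Submission
  imports Defs
begin

text \<open>
  The inclusion of the multipliers in \<open>D_\<beta>\<close> holds because \<open>D_\<alpha>\<close> contains the constant function
  \<open>1\<close>. The converse says that \<open>D_\<alpha> \<cdot> D_\<beta> \<subseteq> D_\<beta>\<close>. The coefficients of a product of two power
  series are the convolution \<open>c = a * b\<close> of the coefficients of the factors. Write \<open>W_\<alpha>\<close> for the
  weight that defines \<open>D_\<alpha>\<close>. The Cauchy--Schwarz inequality, applied to the finite sum
  \<open>c(r) = (\<Sum>p + q = r. a(p) b(q))\<close> after inserting the factor \<open>(W_\<alpha>(p) W_\<beta>(q))\<^sup>1\<^sup>/\<^sup>2\<close>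
  and its reciprocal, gives

  \<open>\<bar>c(r)\<bar>\<^sup>2 W_\<beta>(r) \<le>
     (\<Sum>p + q = r. W_\<beta>(r) / (W_\<alpha>(p) W_\<beta>(q))) \<cdot> (\<Sum>p + q = r. \<bar>a(p)\<bar>\<^sup>2 W_\<alpha>(p) \<bar>b(q)\<bar>\<^sup>2 W_\<beta>(q))\<close>.

  The sum over \<open>r\<close> of the second factor is the product of the squared norms of the two functions,
  so everything rests on bounding the first factor, the kernel sum, independently of \<open>r\<close>
  (lemma \<open>kernel_sum_bounded\<close>). As the weights are products, this is a question about one
  variable, and there it follows from the pointwise estimate \<open>kernel_bound\<close>, which treats all real
  exponents \<open>\<beta> \<le> \<alpha>\<close>, negative ones included, at once; the remaining series
  \<open>\<Sum>k. (k + 1)\<^sup>-\<^sup>\<alpha>\<close> converges because \<open>\<alpha> > 1\<close>.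
\<close>

section \<open>Convolution of double sequences\<close>

definition conv :: "(nat \<times> nat \<Rightarrow> 'a::semiring_0) \<Rightarrow> (nat \<times> nat \<Rightarrow> 'a) \<Rightarrow> nat \<times> nat \<Rightarrow> 'a" where
  "conv a b = (\<lambda>(n, m). \<Sum>(k, l)\<in>{..n} \<times> {..m}. a (k, l) * b (n - k, m - l))"

text \<open>
  Absolute convergence makes the products summable over \<open>A \<times> B\<close>; the value is then found by
  summing over \<open>B\<close> first.
\<close>

lemma has_sum_product:
  fixes u :: "'i \<Rightarrow> 'a::{real_normed_div_algebra, banach, second_countable_topology}"
    and v :: "'j \<Rightarrow> 'a"
  assumes "(u has_sum U) A" "(\<lambda>i. norm (u i)) summable_on A" "(v has_sum V) B" "(\<lambda>i. norm (v i)) summable_on B"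
  shows "((\<lambda>(p, q). u p * v q) has_sum (U * V)) (A \<times> B)"
proof -
  have "(\<lambda>x. norm (case x of (p, q) \<Rightarrow> u p * v q)) summable_on (A \<times> B)"
    unfolding Infinite_Sum.abs_summable_on_Sigma_iff using assms(2,4)
    by (auto simp: norm_mult infsum_cmult_right' abs_mult
        intro!: summable_on_cmult_right summable_on_cmult_left)
  then obtain S where S: "((\<lambda>(p, q). u p * v q) has_sum S) (A \<times> B)"
    using Infinite_Sum.abs_summable_summable unfolding summable_on_def by blast
  have "((\<lambda>p. u p * V) has_sum S) A"
    by (rule has_sum_SigmaD[OF S]) (simp add: has_sum_cmult_right assms(3))
  moreover have "((\<lambda>p. u p * V) has_sum (U * V)) A"
    by (rule has_sum_cmult_left) (rule assms(1))
  ultimately show ?thesis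
    using S has_sum_unique by blast
qed

text \<open>
  The Cauchy product for double series: the pairs \<open>(p, q)\<close> of indices are grouped by the value
  of \<open>p + q\<close>.
\<close>

lemma has_sum_conv:
  fixes u v :: "nat \<times> nat \<Rightarrow> 'a::{real_normed_field, banach, second_countable_topology}"
  assumes "(u has_sum U) UNIV" "(\<lambda>i. norm (u i)) summable_on UNIV" "(v has_sum V) UNIV" "(\<lambda>i. norm (v i)) summable_on UNIV"
  shows "(conv u v has_sum (U * V)) UNIV"
proof -
  define g :: "(nat \<times> nat) \<times> (nat \<times> nat) \<Rightarrow> (nat \<times> nat) \<times> (nat \<times> nat)"
    where "g = (\<lambda>((n, m), (k, l)). ((k, l), (n - k, m - l)))"
  have bij: "bij_betw g (Sigma UNIV (\<lambda>(n, m). {..n} \<times> {..m})) (UNIV \<times> UNIV)"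
    by (rule bij_betw_byWitness[where f' = "\<lambda>((k, l), (i, j)). ((k + i, l + j), (k, l))"])
      (auto simp: g_def)
  have "((\<lambda>x. (\<lambda>(p, q). u p * v q) (g x)) has_sum (U * V))
          (Sigma UNIV (\<lambda>(n, m). {..n} \<times> {..m}))"
    unfolding has_sum_reindex_bij_betw[OF bij] by (rule has_sum_product) fact+
  then show ?thesis
    by (rule has_sum_SigmaD)
      (auto simp: conv_def g_def case_prod_unfold intro!: has_sum_finiteI)
qed

section \<open>The kernel estimate\<close>

text \<open>
  Let \<open>n = j + k\<close>. If \<open>k \<le> j\<close>, the quotient \<open>(n + 1) / (j + 1)\<close> lies between \<open>1\<close> and \<open>2\<close>,
  so its power with exponent \<open>\<beta>\<close> is at most its power with exponent \<open>\<alpha>\<close>, hence at most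
  \<open>2\<^sup>\<alpha>\<close>; the factor \<open>(k + 1)\<^sup>-\<^sup>\<alpha>\<close> remains. If \<open>j < k\<close>, the quotient
  \<open>(n + 1) / (k + 1)\<close> is at most \<open>2\<close>, and the left-hand side is
  \<open>((n + 1) / (k + 1))\<^sup>\<alpha> ((j + 1) / (n + 1))\<^sup>\<alpha>\<^sup>-\<^sup>\<beta> (j + 1)\<^sup>-\<^sup>\<alpha>\<close>, where the second
  factor is at most \<open>1\<close> because \<open>\<beta> \<le> \<alpha>\<close>.
\<close>

lemma kernel_bound:
  fixes \<alpha> \<beta> :: real and j k :: nat
  assumes "0 \<le> \<alpha>" "\<beta> \<le> \<alpha>"
  shows "(real (j + k) + 1) powr \<beta> / ((real k + 1) powr \<alpha> * (real j + 1) powr \<beta>)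
           \<le> 2 powr \<alpha> * ((real k + 1) powr - \<alpha> + (real j + 1) powr - \<alpha>)"
proof -
  define N K J where "N = real (j + k) + 1" and "K = real k + 1" and "J = real j + 1"
  have pos: "N > 0" "K > 0" "J > 0" and le: "J \<le> N" "K \<le> N"
    by (auto simp: N_def K_def J_def)
  have "N powr \<beta> / (K powr \<alpha> * J powr \<beta>) \<le> 2 powr \<alpha> * (K powr - \<alpha> + J powr - \<alpha>)"
  proof (cases "k \<le> j")
    case True
    then have N2: "N \<le> 2 * J" by (simp add: N_def J_def)
    have "N powr \<beta> / (K powr \<alpha> * J powr \<beta>) = (N / J) powr \<beta> * K powr - \<alpha>"
      using pos by (simp add: powr_divide powr_minus field_simps)
    also have "(N / J) powr \<beta> \<le> (N / J) powr \<alpha>"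
      using pos le assms by (intro powr_mono) auto
    also have "\<dots> \<le> 2 powr \<alpha>"
      using pos N2 assms by (intro powr_mono2) (auto simp: field_simps)
    finally show ?thesis
      by (simp add: mult_right_mono distrib_left add_increasing2)
  next
    case False
    then have N2: "N \<le> 2 * K" by (simp add: N_def K_def)
    have "N powr \<beta> / (K powr \<alpha> * J powr \<beta>) = (N / K) powr \<alpha> * ((J / N) powr (\<alpha> - \<beta>) * J powr - \<alpha>)"
      using pos by (simp add: powr_divide powr_minus powr_diff field_simps)
    also have "\<dots> \<le> 2 powr \<alpha> * (1 * J powr - \<alpha>)"
    proof (intro mult_mono order_refl)
      show "(N / K) powr \<alpha> \<le> 2 powr \<alpha>"
        using pos N2 assms by (intro powr_mono2) (auto simp: field_simps)
      show "(J / N) powr (\<alpha> - \<beta>) \<le> 1"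
        using pos le assms by (intro powr_le1) auto
    qed auto
    finally show ?thesis
      by (simp add: distrib_left add_increasing)
  qed
  then show ?thesis by (simp add: N_def K_def J_def)
qed

text \<open>
  The reflection \<open>k \<mapsto> n - k\<close> shows that the two terms of \<open>kernel_bound\<close> contribute equally
  to the sum, each with a partial sum of the convergent series \<open>\<Sum>k. (k + 1)\<^sup>-\<^sup>\<alpha>\<close>.
\<close>

lemma kernel_sum_bounded:
  fixes \<alpha> \<beta> :: real
  assumes "1 < \<alpha>" "\<beta> \<le> \<alpha>"
  obtains C where "\<And>n. (\<Sum>k\<le>n. (real n + 1) powr \<beta> /
      ((real k + 1) powr \<alpha> * (real (n - k) + 1) powr \<beta>)) \<le> C"
proof
  fix n :: nat
  define z where "z k = (real k + 1) powr - \<alpha>" for k :: nat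
  have "summable (\<lambda>k. real k powr - \<alpha>)"
    using assms by (simp add: summable_real_powr_iff)
  then have z: "summable z"
    unfolding z_def by (subst (asm) summable_Suc_iff[symmetric]) (simp add: add.commute)
  have "(\<Sum>k\<le>n. (real n + 1) powr \<beta> / ((real k + 1) powr \<alpha> * (real (n - k) + 1) powr \<beta>))
          \<le> (\<Sum>k\<le>n. 2 powr \<alpha> * (z k + z (n - k)))"
  proof (rule sum_mono)
    fix k assume "k \<in> {..n}"
    then show "(real n + 1) powr \<beta> / ((real k + 1) powr \<alpha> * (real (n - k) + 1) powr \<beta>)
                 \<le> 2 powr \<alpha> * (z k + z (n - k))"
      using kernel_bound[of \<alpha> \<beta> "n - k" k] assms by (simp add: z_def)
  qed
  also have "\<dots> = 2 powr \<alpha> * ((\<Sum>k\<le>n. z k) + (\<Sum>k\<le>n. z (n - k)))"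
    by (simp add: sum_distrib_left[symmetric] sum.distrib)
  also have "(\<Sum>k\<le>n. z (n - k)) = (\<Sum>k\<le>n. z k)"
    by (rule sum.reindex_bij_witness[where i = "\<lambda>k. n - k" and j = "\<lambda>k. n - k"]) auto
  also have "(\<Sum>k\<le>n. z k) \<le> suminf z"
    by (rule sum_le_suminf[OF z]) (auto simp: z_def)
  finally show "(\<Sum>k\<le>n. (real n + 1) powr \<beta> / ((real k + 1) powr \<alpha> * (real (n - k) + 1) powr \<beta>))
      \<le> 2 powr \<alpha> * (suminf (\<lambda>k. (real k + 1) powr - \<alpha>) + suminf (\<lambda>k. (real k + 1) powr - \<alpha>))"
    by (simp add: z_def[abs_def])
qed

section \<open>Weighted square summability\<close>

definition weight :: "real \<times> real \<Rightarrow> nat \<times> nat \<Rightarrow> real" where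
  "weight \<alpha> = (\<lambda>(k, l). (real k + 1) powr fst \<alpha> * (real l + 1) powr snd \<alpha>)"

lemma weight_pos: "weight \<alpha> p > 0"
  by (simp add: weight_def case_prod_unfold)

text \<open>
  The kernel sum factors into two sums in one variable because the weights do.
\<close>

lemma weight_kernel_sum_bounded:
  assumes "\<alpha> \<succ> (1, 1)" and "\<beta> \<preceq> \<alpha>"
  obtains K where "\<And>n m. (\<Sum>(k, l)\<in>{..n} \<times> {..m}.
      weight \<beta> (n, m) / (weight \<alpha> (k, l) * weight \<beta> (n - k, m - l))) \<le> K"
proof -
  obtain C where C: "\<And>n. (\<Sum>k\<le>n. (real n + 1) powr fst \<beta> /
      ((real k + 1) powr fst \<alpha> * (real (n - k) + 1) powr fst \<beta>)) \<le> C"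
    using assms kernel_sum_bounded[of "fst \<alpha>" "fst \<beta>"]
    unfolding pair_gt_def pair_le_def by auto
  obtain D where D: "\<And>n. (\<Sum>k\<le>n. (real n + 1) powr snd \<beta> /
      ((real k + 1) powr snd \<alpha> * (real (n - k) + 1) powr snd \<beta>)) \<le> D"
    using assms kernel_sum_bounded[of "snd \<alpha>" "snd \<beta>"]
    unfolding pair_gt_def pair_le_def by auto
  show thesis
  proof
    fix n m :: nat
    have "(\<Sum>(k, l)\<in>{..n} \<times> {..m}. weight \<beta> (n, m) / (weight \<alpha> (k, l) * weight \<beta> (n - k, m - l)))
        = (\<Sum>k\<le>n. (real n + 1) powr fst \<beta> /
              ((real k + 1) powr fst \<alpha> * (real (n - k) + 1) powr fst \<beta>)) *
          (\<Sum>l\<le>m. (real m + 1) powr snd \<beta> /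
              ((real l + 1) powr snd \<alpha> * (real (m - l) + 1) powr snd \<beta>))"
      unfolding sum_product sum.cartesian_product
      by (intro sum.cong refl) (auto simp: weight_def mult_ac)
    also have "\<dots> \<le> C * D"
      by (intro mult_mono C D order_trans[OF _ C[of 0]] sum_nonneg) auto
    finally show "(\<Sum>(k, l)\<in>{..n} \<times> {..m}.
        weight \<beta> (n, m) / (weight \<alpha> (k, l) * weight \<beta> (n - k, m - l))) \<le> C * D" .
  qed
qed

lemma weighted_Cauchy_Schwarz:
  fixes a b :: "'i \<Rightarrow> 'a::real_normed_field" and w :: "'i \<Rightarrow> real"
  assumes "\<And>i. i \<in> I \<Longrightarrow> 0 < w i"
  shows "(norm (\<Sum>i\<in>I. a i * b i))\<^sup>2
           \<le> (\<Sum>i\<in>I. 1 / w i) * (\<Sum>i\<in>I. (norm (a i))\<^sup>2 * (norm (b i))\<^sup>2 * w i)"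
proof -
  have "norm (\<Sum>i\<in>I. a i * b i) \<le> (\<Sum>i\<in>I. norm (a i) * norm (b i))"
    by (metis (mono_tags, lifting) norm_mult sum_norm_le order_refl)
  also have "\<dots> = (\<Sum>i\<in>I. (1 / sqrt (w i)) * (norm (a i) * norm (b i) * sqrt (w i)))"
    using assms by (intro sum.cong) force+
  finally have "(norm (\<Sum>i\<in>I. a i * b i))\<^sup>2
      \<le> (\<Sum>i\<in>I. (1 / sqrt (w i)) * (norm (a i) * norm (b i) * sqrt (w i)))\<^sup>2"
    by (intro power_mono) auto
  also have "\<dots> \<le> (\<Sum>i\<in>I. (1 / sqrt (w i))\<^sup>2) * (\<Sum>i\<in>I. (norm (a i) * norm (b i) * sqrt (w i))\<^sup>2)"
    by (rule Cauchy_Schwarz_ineq_sum)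
  also have "\<dots> = (\<Sum>i\<in>I. 1 / w i) * (\<Sum>i\<in>I. (norm (a i))\<^sup>2 * (norm (b i))\<^sup>2 * w i)"
    using assms
    by (intro arg_cong2[where f = "(*)"] sum.cong refl) (auto simp: power_mult_distrib power_divide less_imp_le)
  finally show ?thesis .
qed

text \<open>
  Cauchy--Schwarz with the weights \<open>W_\<alpha>(p) W_\<beta>(q)\<close> bounds \<open>\<bar>(a * b)(r)\<bar>\<^sup>2 W_\<beta>(r)\<close> by a constant
  times \<open>(A * B)(r)\<close>, where \<open>A = \<bar>a\<bar>\<^sup>2 W_\<alpha>\<close> and \<open>B = \<bar>b\<bar>\<^sup>2 W_\<beta>\<close> are summable; and the
  convolution of two absolutely summable families is summable.
\<close>

lemma conv_weight_summable:
  fixes a b :: "nat \<times> nat \<Rightarrow> complex"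
  assumes "\<alpha> \<succ> (1, 1)" and "\<beta> \<preceq> \<alpha>"
    and a: "(\<lambda>p. (cmod (a p))\<^sup>2 * weight \<alpha> p) summable_on UNIV"
    and b: "(\<lambda>p. (cmod (b p))\<^sup>2 * weight \<beta> p) summable_on UNIV"
  shows "(\<lambda>p. (cmod (conv a b p))\<^sup>2 * weight \<beta> p) summable_on UNIV"
proof -
  define A where "A p = (cmod (a p))\<^sup>2 * weight \<alpha> p" for p
  define B where "B p = (cmod (b p))\<^sup>2 * weight \<beta> p" for p
  obtain K where K: "\<And>n m. (\<Sum>(k, l)\<in>{..n} \<times> {..m}.
      weight \<beta> (n, m) / (weight \<alpha> (k, l) * weight \<beta> (n - k, m - l))) \<le> K"
    using weight_kernel_sum_bounded[OF assms(1,2)] by blast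
  have nonneg: "A p \<ge> 0" "B p \<ge> 0" for p
    using weight_pos[of \<alpha> p] weight_pos[of \<beta> p] by (simp_all add: A_def B_def)
  have "A summable_on UNIV" "B summable_on UNIV"
    using a b by (simp_all add: A_def[abs_def] B_def[abs_def])
  then have "conv A B summable_on UNIV"
    using has_sum_conv[of A "infsum A UNIV" B "infsum B UNIV"] nonneg
    by (auto simp: has_sum_infsum intro: has_sum_imp_summable)
  then have "(\<lambda>p. K * conv A B p) summable_on UNIV"
    by (rule summable_on_cmult_right)
  then show ?thesis
  proof (rule summable_on_comparison_test)
    fix p :: "nat \<times> nat"
    obtain n m where p: "p = (n, m)" by force
    let ?w = "\<lambda>i. weight \<alpha> i * weight \<beta> (n - fst i, m - snd i)"
    let ?I = "{..n} \<times> {..m}"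
    have "(cmod (conv a b p))\<^sup>2 \<le> (\<Sum>i\<in>?I. 1 / ?w i) *
        (\<Sum>i\<in>?I. (cmod (a i))\<^sup>2 * (cmod (b (n - fst i, m - snd i)))\<^sup>2 * ?w i)"
      using weighted_Cauchy_Schwarz[of ?I ?w a "\<lambda>i. b (n - fst i, m - snd i)"]
      by (simp add: weight_pos p conv_def case_prod_unfold)
    also have "(\<Sum>i\<in>?I. (cmod (a i))\<^sup>2 * (cmod (b (n - fst i, m - snd i)))\<^sup>2 * ?w i) = conv A B p"
      by (simp add: p conv_def A_def B_def case_prod_unfold mult_ac)
    finally have "(cmod (conv a b p))\<^sup>2 * weight \<beta> p
        \<le> (\<Sum>i\<in>?I. 1 / ?w i) * conv A B p * weight \<beta> p"
      using weight_pos[of \<beta> p] by (intro mult_right_mono) auto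
    also have "\<dots> = (\<Sum>i\<in>?I. weight \<beta> p / ?w i) * conv A B p"
      by (simp add: sum_distrib_left mult_ac)
    also have "\<dots> \<le> K * conv A B p"
      using K[where n = n and m = m]
      by (intro mult_right_mono)
        (auto simp: p case_prod_unfold conv_def intro!: sum_nonneg mult_nonneg_nonneg nonneg)
    finally show "(cmod (conv a b p))\<^sup>2 * weight \<beta> p \<le> K * conv A B p" .
  qed (simp add: weight_pos less_imp_le)
qed

section \<open>Products of functions in the weighted spaces\<close>

definition coeffs_of :: "(complex \<times> complex \<Rightarrow> complex) \<Rightarrow> (nat \<times> nat \<Rightarrow> complex) \<Rightarrow> bool" where
  "coeffs_of f a \<longleftrightarrow>
     (\<forall>(z, w)\<in>bidisc. ((\<lambda>(k, l). a (k, l) * z ^ k * w ^ l) has_sum f (z, w)) UNIV)"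

lemma D_space_iff:
  "f \<in> D_space \<alpha> \<longleftrightarrow> f \<in> extensional bidisc \<and>
     (\<exists>a. coeffs_of f a \<and> (\<lambda>p. (cmod (a p))\<^sup>2 * weight \<alpha> p) summable_on UNIV)"
  by (simp add: D_space_def coeffs_of_def weight_def case_prod_unfold mult.assoc)

text \<open>
  A convergent double series of complex numbers converges absolutely, so the
  Cauchy product applies at each point of the bidisc.
\<close>

lemma coeffs_of_mult:
  assumes "coeffs_of f a" "coeffs_of g b"
  shows "coeffs_of (restrict (\<lambda>p. f p * g p) bidisc) (conv a b)"
  unfolding coeffs_of_def
proof safe
  fix z w :: complex
  assume zw: "(z, w) \<in> bidisc"
  define u where "u = (\<lambda>(k, l). a (k, l) * z ^ k * w ^ l)"
  define v where "v = (\<lambda>(k, l). b (k, l) * z ^ k * w ^ l)"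
  have u: "(u has_sum f (z, w)) UNIV" and v: "(v has_sum g (z, w)) UNIV"
    using assms zw unfolding coeffs_of_def u_def v_def by auto
  have "(conv u v has_sum (f (z, w) * g (z, w))) UNIV"
    using u v by (intro has_sum_conv)
      (auto simp: summable_on_iff_abs_summable_on_complex[symmetric] intro: has_sum_imp_summable)
  moreover have "conv u v (n, m) = conv a b (n, m) * z ^ n * w ^ m" for n m
  proof -
    have "u (k, l) * v (n - k, m - l) = a (k, l) * b (n - k, m - l) * (z ^ n * w ^ m)"
      if "k \<le> n" "l \<le> m" for k l
    proof -
      have "z ^ n = z ^ k * z ^ (n - k)" "w ^ m = w ^ l * w ^ (m - l)"
        using that by (simp_all flip: power_add)
      then show ?thesis
        by (simp only: u_def v_def prod.case mult_ac)
    qed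
    then have "conv u v (n, m) = conv a b (n, m) * (z ^ n * w ^ m)"
      unfolding conv_def prod.case sum_distrib_right by (intro sum.cong refl) auto
    then show ?thesis
      by (simp only: mult.assoc)
  qed
  then have "conv u v = (\<lambda>(n, m). conv a b (n, m) * z ^ n * w ^ m)"
    by auto
  ultimately show "((\<lambda>(n, m). conv a b (n, m) * z ^ n * w ^ m) has_sum
      restrict (\<lambda>p. f p * g p) bidisc (z, w)) UNIV"
    using zw by simp
qed

lemma D_space_mult:
  assumes "\<alpha> \<succ> (1, 1)" and "\<beta> \<preceq> \<alpha>" and "f \<in> D_space \<alpha>" and "g \<in> D_space \<beta>"
  shows "restrict (\<lambda>p. f p * g p) bidisc \<in> D_space \<beta>"
  using assms coeffs_of_mult conv_weight_summable unfolding D_space_iff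
  by (meson restrict_extensional)

lemma one_in_D_space: "restrict (\<lambda>_. 1) bidisc \<in> D_space \<alpha>"
proof -
  define e :: "nat \<times> nat \<Rightarrow> complex" where "e p = (if p = (0, 0) then 1 else 0)" for p
  have "coeffs_of (restrict (\<lambda>_. 1) bidisc) e"
    unfolding coeffs_of_def
  proof safe
    fix z w :: complex
    assume "(z, w) \<in> bidisc"
    then show "((\<lambda>(k, l). e (k, l) * z ^ k * w ^ l) has_sum restrict (\<lambda>_. 1) bidisc (z, w)) UNIV"
      by (intro has_sum_finite_neutralI[where B = "{(0, 0)}"]) (auto simp: e_def split: if_splits)
  qed
  moreover have "((\<lambda>p. (cmod (e p))\<^sup>2 * weight \<alpha> p) has_sum weight \<alpha> (0, 0)) UNIV"
    by (intro has_sum_finite_neutralI[where B = "{(0, 0)}"]) (auto simp: e_def)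
  ultimately show ?thesis
    unfolding D_space_iff by (auto intro: has_sum_imp_summable)
qed

theorem theorem3p10:
  fixes \<alpha> \<beta> :: "real \<times> real"
  assumes "\<alpha> \<succ> (1, 1)" and "\<beta> \<preceq> \<alpha>"
  shows "multipliers \<alpha> \<beta> = D_space \<beta>"
proof
  show "multipliers \<alpha> \<beta> \<subseteq> D_space \<beta>"
  proof
    fix \<phi> assume \<phi>: "\<phi> \<in> multipliers \<alpha> \<beta>"
    then have "restrict (\<lambda>p. \<phi> p * restrict (\<lambda>_. 1) bidisc p) bidisc \<in> D_space \<beta>"
      using one_in_D_space unfolding multipliers_def by blast
    moreover have "restrict (\<lambda>p. \<phi> p * restrict (\<lambda>_. 1) bidisc p) bidisc = \<phi>"
      using \<phi> by (auto simp: multipliers_def extensional_def)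
    ultimately show "\<phi> \<in> D_space \<beta>" by simp
  qed
  show "D_space \<beta> \<subseteq> multipliers \<alpha> \<beta>"
  proof
    fix \<phi> assume \<phi>: "\<phi> \<in> D_space \<beta>"
    have "restrict (\<lambda>p. \<phi> p * f p) bidisc \<in> D_space \<beta>" if "f \<in> D_space \<alpha>" for f
      using D_space_mult[OF assms that \<phi>] by (simp only: mult.commute)
    then show "\<phi> \<in> multipliers \<alpha> \<beta>"
      using \<phi> by (simp add: multipliers_def D_space_iff)
  qed
qed

end
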